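(* Let $\mathcal{A}$ be a monounary algebra. Then $\mathcal{A}$ is ultrahomogeneous if and only if $\mathcal{A}$ is $1$-ultrahomogeneous.
   Context: A monounary algebra is a pair $\mathcal{A}=(A;\theta)$ where $A$ is a nonempty set (of arbitrary cardinality) and $\theta\colon A\to A$ is a function. A subalgebra is a nonempty subset closed under $\theta$, with the restricted operation; for nonempty $B\subseteq A$, $\langle B\rangle=\{\theta^n(b): b\in B, n\geq 0\}$ is the subalgebra generated by $B$. A subalgebra is $n$-generated if it can be generated by $n$ elements. An isomorphism of monounary algebras is a bijection commuting with the unary operations. For $n\in\mathbb{N}=\{1,2,\dots\}$, $\mathcal{A}$ is $n$-ultrahomogeneous if every isomorphism between $n$-generated subalgebras of $\mathcal{A}$ extends to an automorphism of $\mathcal{A}$; $\mathcal{A}$ is ultrahomogeneous if it is $n$-ultrahomogeneous for every $n\in\mathbb{N}$. *)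

theory Defs
  imports Main "HOL-Library.FuncSet"
begin

text \<open>
  The operation \<open>\<theta>\<close> is a total HOL function; only its values on the carrier \<open>A\<close> matter.
\<close>

definition monounary_algebra :: "'a set \<Rightarrow> ('a \<Rightarrow> 'a) \<Rightarrow> bool" where
  "monounary_algebra A \<theta> \<longleftrightarrow> A \<noteq> {} \<and> \<theta> \<in> A \<rightarrow> A"

definition subalgebra :: "'a set \<Rightarrow> 'a set \<Rightarrow> ('a \<Rightarrow> 'a) \<Rightarrow> bool" where
  "subalgebra B A \<theta> \<longleftrightarrow> B \<noteq> {} \<and> B \<subseteq> A \<and> (\<forall>x\<in>B. \<theta> x \<in> B)"

definition generated :: "('a \<Rightarrow> 'a) \<Rightarrow> 'a set \<Rightarrow> 'a set" where
  "generated \<theta> X = {(\<theta> ^^ n) x | n x. x \<in> X}"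

text \<open>
  The \<open>n\<close> generators need not be distinct, so there is a generating set with at most \<open>n\<close> elements.
\<close>

definition n_generated_subalgebra :: "nat \<Rightarrow> 'a set \<Rightarrow> 'a set \<Rightarrow> ('a \<Rightarrow> 'a) \<Rightarrow> bool" where
  "n_generated_subalgebra n B A \<theta> \<longleftrightarrow> subalgebra B A \<theta> \<and>
     (\<exists>X. X \<noteq> {} \<and> X \<subseteq> A \<and> finite X \<and> card X \<le> n \<and> B = generated \<theta> X)"

text \<open>
  All algebras compared below are subalgebras of one algebra, so a single operation \<open>\<theta>\<close> suffices.
\<close>

definition isomorphism :: "('a \<Rightarrow> 'a) \<Rightarrow> ('a \<Rightarrow> 'a) \<Rightarrow> 'a set \<Rightarrow> 'a set \<Rightarrow> bool" where
  "isomorphism \<theta> f B C \<longleftrightarrow> bij_betw f B C \<and> (\<forall>x\<in>B. f (\<theta> x) = \<theta> (f x))"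

definition automorphism :: "('a \<Rightarrow> 'a) \<Rightarrow> ('a \<Rightarrow> 'a) \<Rightarrow> 'a set \<Rightarrow> bool" where
  "automorphism \<theta> g A \<longleftrightarrow> isomorphism \<theta> g A A"

definition n_ultrahomogeneous :: "nat \<Rightarrow> 'a set \<Rightarrow> ('a \<Rightarrow> 'a) \<Rightarrow> bool" where
  "n_ultrahomogeneous n A \<theta> \<longleftrightarrow>
     (\<forall>B C f. n_generated_subalgebra n B A \<theta> \<longrightarrow> n_generated_subalgebra n C A \<theta> \<longrightarrow>
        isomorphism \<theta> f B C \<longrightarrow> (\<exists>g. automorphism \<theta> g A \<and> (\<forall>x\<in>B. g x = f x)))"

definition ultrahomogeneous :: "'a set \<Rightarrow> ('a \<Rightarrow> 'a) \<Rightarrow> bool" where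
  "ultrahomogeneous A \<theta> \<longleftrightarrow> (\<forall>n\<ge>1. n_ultrahomogeneous n A \<theta>)"

end

theory Submission imports Defs
begin

text \<open>
  An isomorphism between finitely generated subalgebras is extended one generator at a time.
  After composing with an automorphism it fixes a subalgebra \<open>P\<close> pointwise and sends one further
  generator \<open>b\<close> to \<open>c\<close>; 1-ultrahomogeneity yields an automorphism \<open>h\<close> with \<open>h b = c\<close>. Let \<open>S\<close> be
  the set of points whose orbit meets the orbit of \<open>b\<close> outside \<open>P\<close> (a whole component, or the
  points above the last \<open>\<theta>\<^sup>i b \<notin> P\<close>). Then \<open>S\<close> misses \<open>P\<close>, and \<open>h ` S\<close> is equal to or disjoint
  from \<open>S\<close>. The map which is \<open>h\<close> on \<open>S\<close>, \<open>h\<inverse>\<close> on \<open>h ` S\<close> when that is disjoint from \<open>S\<close>, and the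
  identity elsewhere is an automorphism fixing \<open>P\<close> and sending \<open>b\<close> to \<open>c\<close>.
\<close>

section \<open>Orbits and generated subalgebras\<close>

lemma funpow_closed:
  assumes "\<And>x. x \<in> B \<Longrightarrow> \<theta> x \<in> B" "x \<in> B"
  shows "(\<theta> ^^ n) x \<in> B"
  using assms by (induction n) auto

lemma funpow_commute:
  assumes "\<And>x. x \<in> B \<Longrightarrow> \<theta> x \<in> B" "\<And>x. x \<in> B \<Longrightarrow> f (\<theta> x) = \<theta> (f x)" "x \<in> B"
  shows "f ((\<theta> ^^ n) x) = (\<theta> ^^ n) (f x)"
  by (induction n) (use assms funpow_closed[of B \<theta>] in auto)

lemma generated_closed: "x \<in> generated \<theta> X \<Longrightarrow> \<theta> x \<in> generated \<theta> X"
proof -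
  assume "x \<in> generated \<theta> X"
  then obtain n y where "y \<in> X" "\<theta> x = (\<theta> ^^ Suc n) y" unfolding generated_def by auto
  then show ?thesis unfolding generated_def by blast
qed

lemma generated_superset: "X \<subseteq> generated \<theta> X"
  unfolding generated_def by (auto intro: exI[of _ 0])

lemma generated_insert: "generated \<theta> (insert b X) = generated \<theta> {b} \<union> generated \<theta> X"
  unfolding generated_def by auto

lemma generated_subset:
  assumes "\<And>x. x \<in> A \<Longrightarrow> \<theta> x \<in> A" "X \<subseteq> A"
  shows "generated \<theta> X \<subseteq> A"
  using assms funpow_closed[of A \<theta>] unfolding generated_def by auto

section \<open>The group of automorphisms\<close>

lemma automorphismD:
  assumes "automorphism \<theta> g A"
  shows "bij_betw g A A" "x \<in> A \<Longrightarrow> g (\<theta> x) = \<theta> (g x)"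
  using assms unfolding automorphism_def isomorphism_def by auto

lemma automorphism_id: "automorphism \<theta> id A"
  unfolding automorphism_def isomorphism_def by (simp add: bij_betw_def)

lemma automorphism_comp:
  assumes "automorphism \<theta> g A" "automorphism \<theta> h A"
  shows "automorphism \<theta> (g \<circ> h) A"
  using assms unfolding automorphism_def isomorphism_def
  by (auto intro: bij_betw_trans dest: bij_betwE)

lemma automorphism_inv:
  assumes closed: "\<And>x. x \<in> A \<Longrightarrow> \<theta> x \<in> A" and g: "automorphism \<theta> g A"
  shows "automorphism \<theta> (inv_into A g) A"
proof -
  note bij = automorphismD(1)[OF g]
  have inv: "inv_into A g x \<in> A" if "x \<in> A" for x
    using bij_betw_inv_into[OF bij] that by (auto dest: bij_betwE)
  have "inv_into A g (\<theta> x) = \<theta> (inv_into A g x)" if "x \<in> A" for x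
  proof -
    have "g (\<theta> (inv_into A g x)) = \<theta> x"
      using automorphismD(2)[OF g inv[OF that]] bij that by (simp add: bij_betw_inv_into_right)
    then show ?thesis
      using bij_betw_inv_into_left[OF bij closed[OF inv[OF that]]] by simp
  qed
  then show ?thesis
    using bij_betw_inv_into[OF bij] unfolding automorphism_def isomorphism_def by auto
qed

section \<open>Gluing an automorphism with the identity\<close>

text \<open>
  The boundary condition says that \<open>h\<close> and its inverse agree with the identity at the points where
  an orbit leaves \<open>S\<close> or \<open>h ` S\<close>, so that the pieces fit together.
\<close>

lemma automorphism_swap:
  assumes closed: "\<And>x. x \<in> A \<Longrightarrow> \<theta> x \<in> A" and h: "automorphism \<theta> h A"
    and S: "S \<subseteq> A" "h ` S = S \<or> S \<inter> h ` S = {}"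
    and pre: "\<And>x. \<lbrakk>x \<in> A; \<theta> x \<in> S\<rbrakk> \<Longrightarrow> x \<in> S"
    and boundary: "\<And>x. \<lbrakk>x \<in> S; \<theta> x \<notin> S\<rbrakk> \<Longrightarrow> \<theta> x \<notin> h ` S \<and> h (\<theta> x) = \<theta> x"
  shows "\<exists>k. automorphism \<theta> k A \<and> (\<forall>x\<in>S. k x = h x) \<and> (\<forall>x\<in>A - (S \<union> h ` S). k x = x)"
proof -
  \<comment> \<open>The inverse branch is reached only when \<open>h\<close>
    S\<open>is disjoint from\<close>S\<open>, since otherwise\<close>h \<open>S = S\<close>.\<close>
  define k where "k x = (if x \<in> S then h x else if x \<in> h ` S then inv_into A h x else x)" for x
  note bij = automorphismD(1)[OF h] and hom = automorphismD(2)[OF h]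
  note hA = bij_betwE[OF bij, rule_format]
  have inv: "inv_into A h (h x) = x" if "x \<in> A" for x
    using bij_betw_inv_into_left[OF bij that] .
  have inj: "x = y" if "h x = h y" "x \<in> A" "y \<in> A" for x y
    using that inv by metis
  have pre': "x \<in> h ` S" if xA: "x \<in> A" and "\<theta> x \<in> h ` S" for x
  proof -
    obtain y where y: "y \<in> A" "x = h y" using bij xA by (auto simp: bij_betw_def)
    then have "h (\<theta> y) \<in> h ` S" using that hom by auto
    then have "\<theta> y \<in> S" using inj closed y S(1) by blast
    then show ?thesis using pre y by auto
  qed
  have "bij_betw k A A"
  proof (cases "h ` S = S")
    case True
    have "bij_betw h S S"
      using True S(1) bij by (auto intro: bij_betw_subset)
    then have "bij_betw k S S" by (subst bij_betw_cong[of _ _ h]) (auto simp: k_def)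
    moreover have "bij_betw k (A - S) (A - S)"
      by (subst bij_betw_cong[of _ _ id]) (auto simp: k_def True bij_betw_def)
    ultimately have "bij_betw k (S \<union> (A - S)) (S \<union> (A - S))"
      by (rule bij_betw_combine) auto
    then show ?thesis using S(1) by (simp add: Un_absorb1)
  next
    case False
    then have disj: "S \<inter> h ` S = {}" using S(2) by auto
    have kS: "k x = h x" "k (h x) = x" if "x \<in> S" for x
      using that disj S(1) inv by (auto simp: k_def)
    have "k x \<in> A \<and> k (k x) = x" if "x \<in> A" for x
    proof -
      consider "x \<in> S" | y where "y \<in> S" "x = h y" | "x \<notin> S" "x \<notin> h ` S" by auto
      then show ?thesis
      proof cases
        case 1 then show ?thesis using kS hA that by auto
      next
        case 2 then show ?thesis using kS S(1) by auto
      next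
        case 3 then show ?thesis using that by (simp add: k_def)
      qed
    qed
    then show ?thesis by (intro bij_betw_byWitness[where f' = k]) auto
  qed
  moreover have "k (\<theta> x) = \<theta> (k x)" if xA: "x \<in> A" for x
  proof -
    consider "x \<in> S" | "x \<notin> S" "x \<in> h ` S" | "x \<notin> S" "x \<notin> h ` S" by auto
    then show ?thesis
    proof cases
      case 1 then show ?thesis using boundary[OF 1] hom[OF xA] by (auto simp: k_def)
    next
      case 2
      then obtain y where y: "y \<in> S" "x = h y" by auto
      have yA: "y \<in> A" using y S(1) by auto
      have kx: "k x = y" using 2 y yA inv by (simp add: k_def)
      have \<theta>x: "\<theta> x = h (\<theta> y)" using hom[OF yA] y by simp
      have "\<theta> x \<notin> S" using 2 pre xA by blast
      \<comment> \<open>If \<open>\<theta> y\<close> leaves \<open>S\<close>, the boundary condition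
        gives \<open>\<theta> x = h (\<theta> y) = \<theta> y\<close>, a point that \<open>k\<close>
        fixes.\<close>
      show ?thesis
      proof (cases "\<theta> y \<in> S")
        case True
        then show ?thesis using kx \<theta>x \<open>\<theta> x \<notin> S\<close> inv S(1) by (auto simp: k_def)
      next
        case False
        then show ?thesis using kx \<theta>x boundary[OF y(1) False] by (simp add: k_def)
      qed
    next
      case 3 then show ?thesis using pre[OF xA] pre'[OF xA] by (auto simp: k_def)
    qed
  qed
  ultimately have "automorphism \<theta> k A" unfolding automorphism_def isomorphism_def by auto
  then show ?thesis by (intro exI[of _ k]) (auto simp: k_def)
qed

text \<open>\<open>P_iff\<close> and \<open>P_fix\<close> say that the identity on \<open>P\<close>
  and \<open>h\<close> on the orbit of \<open>b\<close> combine to an isomorphism. Since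
  \<open>h\<close> may move \<open>P\<close>, it is kept only on a set around \<open>b\<close> that
  avoids \<open>P\<close>.\<close>

lemma extend_identity:
  assumes closed: "\<And>x. x \<in> A \<Longrightarrow> \<theta> x \<in> A"
    and P: "\<And>x. x \<in> P \<Longrightarrow> \<theta> x \<in> P" and b: "b \<in> A"
    and h: "automorphism \<theta> h A"
    and P_iff: "\<And>i. (\<theta> ^^ i) (h b) \<in> P \<longleftrightarrow> (\<theta> ^^ i) b \<in> P"
    and P_fix: "\<And>i. (\<theta> ^^ i) b \<in> P \<Longrightarrow> (\<theta> ^^ i) (h b) = (\<theta> ^^ i) b"
    and "P \<subseteq> A"
  shows "\<exists>k. automorphism \<theta> k A \<and> (\<forall>x\<in>P. k x = x) \<and> k b = h b"
proof (cases "b \<in> P")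
  case True
  then have "h b = b" using P_fix[of 0] by simp
  then show ?thesis
    using automorphism_id[of \<theta> A] by (intro exI[of _ id]) simp
next
  case False
  \<comment> \<open>\<open>cone b\<close> is the set \<open>S\<close> of the overview; the base
    point is a parameter because the image under \<open>h\<close> is again a cone.\<close>
  define cone where "cone y = {x \<in> A. \<exists>m i. (\<theta> ^^ m) x = (\<theta> ^^ i) y \<and> (\<theta> ^^ i) y \<notin> P}" for y
  note bij = automorphismD(1)[OF h] and hom = automorphismD(2)[OF h]
  note hA = bij_betwE[OF bij, rule_format]
  have pow_hom: "h ((\<theta> ^^ n) x) = (\<theta> ^^ n) (h x)" if "x \<in> A" for n x
    using funpow_commute[of A \<theta> h x n] closed hom that by blast
  have powA: "(\<theta> ^^ n) x \<in> A" if "x \<in> A" for n x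
    using funpow_closed[of A \<theta> x n] closed that by blast
  have inj: "x = y" if "h x = h y" "x \<in> A" "y \<in> A" for x y
    using bij that by (auto simp: bij_betw_def inj_on_def)
  have miss: "x \<notin> P" if "x \<in> cone y" for x y
  proof
    assume "x \<in> P"
    then have "(\<theta> ^^ m) x \<in> P" for m using funpow_closed[of P \<theta> x m] P by blast
    then show False using that unfolding cone_def by auto metis
  qed
  have pre: "x \<in> cone y" if x: "x \<in> A" "\<theta> x \<in> cone y" for x y
  proof -
    obtain m i where "(\<theta> ^^ Suc m) x = (\<theta> ^^ i) y" "(\<theta> ^^ i) y \<notin> P"
      using x(2) unfolding cone_def by (auto simp: funpow_swap1)
    then show ?thesis using x(1) unfolding cone_def by blast
  qed
  \<comment> \<open>Since \<open>h\<close> need not preserve \<open>P\<close>, lying outside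
    \<open>P\<close> is transferred by \<open>P_iff\<close> between the orbits of \<open>b\<close>
    and \<open>h b\<close>.\<close>
  have image: "h ` cone b = cone (h b)"
  proof (intro set_eqI iffI)
    fix z assume "z \<in> h ` cone b"
    then obtain x m i where x: "x \<in> A" "z = h x" "(\<theta> ^^ m) x = (\<theta> ^^ i) b" "(\<theta> ^^ i) b \<notin> P"
      unfolding cone_def by auto
    then have "(\<theta> ^^ m) z = (\<theta> ^^ i) (h b)" using pow_hom b by metis
    then show "z \<in> cone (h b)" using x P_iff hA unfolding cone_def by auto
  next
    fix z assume "z \<in> cone (h b)"
    then obtain m i where z: "z \<in> A" "(\<theta> ^^ m) z = (\<theta> ^^ i) (h b)" "(\<theta> ^^ i) (h b) \<notin> P"
      unfolding cone_def by auto
    obtain x where x: "x \<in> A" "z = h x" using bij z(1) by (auto simp: bij_betw_def)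
    have "h ((\<theta> ^^ m) x) = h ((\<theta> ^^ i) b)" using pow_hom b x z by metis
    then have "(\<theta> ^^ m) x = (\<theta> ^^ i) b"
      using inj powA x b by blast
    then show "z \<in> h ` cone b" using x z P_iff unfolding cone_def by auto
  qed
  \<comment> \<open>A point reaching \<open>y\<close> before the meeting point is pushed forward to
    it; one reaching \<open>y\<close> later already lands on the common tail of both orbits.\<close>
  have shift: "cone y \<subseteq> cone y'" if eq: "(\<theta> ^^ i) y = (\<theta> ^^ j) y'" and out: "(\<theta> ^^ i) y \<notin> P"
    for y y' i j
  proof
    fix x assume "x \<in> cone y"
    then obtain u v where x: "x \<in> A" "(\<theta> ^^ u) x = (\<theta> ^^ v) y" "(\<theta> ^^ v) y \<notin> P"
      unfolding cone_def by auto
    show "x \<in> cone y'"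
    proof (cases "v \<le> i")
      case True
      have "(\<theta> ^^ (i - v + u)) x = (\<theta> ^^ (i - v)) ((\<theta> ^^ v) y)" by (simp add: funpow_add x(2))
      also have "\<dots> = (\<theta> ^^ (i - v + v)) y" by (simp add: funpow_add)
      also have "\<dots> = (\<theta> ^^ j) y'" using True eq by simp
      finally show ?thesis using x(1) eq out unfolding cone_def by auto
    next
      case False
      have "(\<theta> ^^ v) y = (\<theta> ^^ (v - i + i)) y" using False by simp
      also have "\<dots> = (\<theta> ^^ (v - i)) ((\<theta> ^^ j) y')" by (simp add: funpow_add eq)
      also have "\<dots> = (\<theta> ^^ (v - i + j)) y'" by (simp add: funpow_add)
      finally show ?thesis using x unfolding cone_def by fastforce
    qed
  qed
  \<comment> \<open>The orbit of a common point \<open>x\<close> joins those of \<open>y\<close> and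
    \<open>y'\<close>; the later of the two junctions lies on both and outside \<open>P\<close>, so
    \<open>shift\<close> applies in both directions.\<close>
  have meet: "cone y = cone y'" if "x \<in> cone y" "x \<in> cone y'" for x y y'
  proof -
    have "\<exists>i j. (\<theta> ^^ i) y = (\<theta> ^^ j) y' \<and> (\<theta> ^^ i) y \<notin> P"
      if "(\<theta> ^^ m) x = (\<theta> ^^ i) y" "(\<theta> ^^ l) x = (\<theta> ^^ j) y'" "(\<theta> ^^ j) y' \<notin> P" "m \<le> l"
      for m i l j y y'
    proof -
      have "(\<theta> ^^ (l - m + i)) y = (\<theta> ^^ (l - m + m)) x" by (simp add: funpow_add that(1))
      also have "\<dots> = (\<theta> ^^ j) y'" using that by simp
      finally show ?thesis using that(3) by (intro exI[of _ "l - m + i"] exI[of _ j]) simp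
    qed
    note key = this
    obtain m i l j where
      "(\<theta> ^^ m) x = (\<theta> ^^ i) y" "(\<theta> ^^ i) y \<notin> P" "(\<theta> ^^ l) x = (\<theta> ^^ j) y'" "(\<theta> ^^ j) y' \<notin> P"
      using \<open>x \<in> cone y\<close> \<open>x \<in> cone y'\<close> unfolding cone_def by auto
    note ml = this
    obtain i j where "(\<theta> ^^ i) y = (\<theta> ^^ j) y'" "(\<theta> ^^ i) y \<notin> P"
    proof (cases "m \<le> l")
      case True
      then show ?thesis using key[OF ml(1,3,4)] that by blast
    next
      case False
      then have "l \<le> m" by simp
      obtain i j where "(\<theta> ^^ j) y' = (\<theta> ^^ i) y" "(\<theta> ^^ j) y' \<notin> P"
        using key[OF ml(3,1,2) \<open>l \<le> m\<close>] by blast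
      then show ?thesis using that[of i j] by simp
    qed
    then show ?thesis using shift[of i y j y'] shift[of j y' i y] by simp
  qed
  have "\<theta> x \<notin> h ` cone b \<and> h (\<theta> x) = \<theta> x" if x: "x \<in> cone b" "\<theta> x \<notin> cone b" for x
  proof -
    obtain m i where mi: "x \<in> A" "(\<theta> ^^ m) x = (\<theta> ^^ i) b" "(\<theta> ^^ i) b \<notin> P"
      using x unfolding cone_def by auto
    \<comment> \<open>For positive \<open>m\<close>, \<open>\<theta> x\<close> would still reach the
      same point outside \<open>P\<close> and stay in the cone. So \<open>x\<close> lies on the
      orbit of \<open>b\<close>, and its successor must be in \<open>P\<close>, where
      \<open>P_fix\<close> applies.\<close>
    have "m = 0"
    proof (rule ccontr)
      assume "m \<noteq> 0"
      then obtain m' where "m = Suc m'" using not0_implies_Suc by blast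
      then have "(\<theta> ^^ m') (\<theta> x) = (\<theta> ^^ i) b" using mi by (simp add: funpow_swap1)
      then show False using x mi closed unfolding cone_def by auto
    qed
    then have \<theta>x: "\<theta> x = (\<theta> ^^ Suc i) b" using mi by simp
    have "\<theta> x \<in> P"
    proof (rule ccontr)
      assume "\<theta> x \<notin> P"
      then have "(\<theta> ^^ 0) (\<theta> x) = (\<theta> ^^ Suc i) b" "(\<theta> ^^ Suc i) b \<notin> P" using \<theta>x by simp_all
      then have "\<theta> x \<in> cone b" unfolding cone_def using closed[OF mi(1)] by blast
      then show False using x by simp
    qed
    moreover have "h (\<theta> x) = \<theta> x"
      using pow_hom[OF b, of "Suc i"] P_fix[of "Suc i"] \<open>\<theta> x \<in> P\<close> \<theta>x by simp
    ultimately show ?thesis using miss image by auto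
  qed
  note boundary = this
  have disj: "h ` cone b = cone b \<or> cone b \<inter> h ` cone b = {}"
  proof (cases "cone b \<inter> cone (h b) = {}")
    case False
    then obtain x where "x \<in> cone b" "x \<in> cone (h b)" by blast
    then show ?thesis using image meet by simp
  qed (simp add: image)
  have "cone b \<subseteq> A" unfolding cone_def by auto
  from automorphism_swap[OF closed h this disj pre boundary] obtain k where k: "automorphism \<theta> k A" "\<forall>x\<in>cone b. k x = h x"
    "\<forall>x\<in>A - (cone b \<union> h ` cone b). k x = x"
    by blast
  have "(\<theta> ^^ 0) b = (\<theta> ^^ 0) b" "(\<theta> ^^ 0) b \<notin> P" using False by simp_all
  then have "b \<in> cone b" unfolding cone_def using b by blast
  moreover have "k x = x" if "x \<in> P" for x
  proof -
    have "x \<notin> cone b" "x \<notin> h ` cone b" using that miss image by auto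
    then show ?thesis using k(3) that \<open>P \<subseteq> A\<close> by blast
  qed
  ultimately show ?thesis using k by blast
qed

section \<open>Induction on the generators\<close>

text \<open>Stating this for embeddings into \<open>A\<close> lets the map be restricted to fewer
  generators without tracking its image. The induction can start from the empty set, where the
  identity works.\<close>

lemma one_ultrahomogeneous_extend:
  assumes closed: "\<And>x. x \<in> A \<Longrightarrow> \<theta> x \<in> A" and uh: "n_ultrahomogeneous 1 A \<theta>"
    and X: "finite X" "X \<subseteq> A"
    and f: "f ` generated \<theta> X \<subseteq> A" "inj_on f (generated \<theta> X)"
      "\<And>x. x \<in> generated \<theta> X \<Longrightarrow> f (\<theta> x) = \<theta> (f x)"
  shows "\<exists>g. automorphism \<theta> g A \<and> (\<forall>x\<in>generated \<theta> X. g x = f x)"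
  using X f
proof (induction X arbitrary: f rule: finite_induct)
  case empty
  have "generated \<theta> {} = {}" unfolding generated_def by auto
  then show ?case using automorphism_id[of \<theta> A] by auto
next
  case (insert b X)
  define P where "P = generated \<theta> X"
  define Q where "Q = generated \<theta> (insert b X)"
  have Q: "Q = generated \<theta> {b} \<union> P" unfolding Q_def P_def by (rule generated_insert)
  have b: "b \<in> A" "X \<subseteq> A" "b \<in> Q" using insert.prems generated_superset[of "insert b X" \<theta>]
    unfolding Q_def by auto
  have sub: "P \<subseteq> A" unfolding P_def
    using b generated_subset[of A \<theta>] closed by simp
  have QC: "\<theta> x \<in> Q" if "x \<in> Q" for x
    using that unfolding Q_def by (rule generated_closed)
  have PC: "\<theta> x \<in> P" if "x \<in> P" for x
    using that unfolding P_def by (rule generated_closed)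
  have f: "f x \<in> A" "f (\<theta> x) = \<theta> (f x)" if "x \<in> Q" for x
    using insert.prems(2,4) that unfolding Q_def by auto
  have injf: "inj_on f Q" using insert.prems(3) unfolding Q_def .
  obtain g where g: "automorphism \<theta> g A" "\<forall>x\<in>P. g x = f x"
    using insert.IH[of f] b(2) f injf Q unfolding P_def by (force intro: inj_on_subset)
  note gi = automorphism_inv[OF closed g(1)]
  note bijg = automorphismD(1)[OF g(1)] and bijgi = automorphismD(1)[OF gi]
  \<comment> \<open>Undoing \<open>g\<close> reduces the problem to a map that is the identity on
    \<open>P\<close>.\<close>
  define f' where "f' x = inv_into A g (f x)" for x
  have f'A: "f' x \<in> A" if "x \<in> Q" for x
    using f(1)[OF that] bijgi unfolding f'_def by (auto dest: bij_betwE)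
  have f'hom: "f' (\<theta> x) = \<theta> (f' x)" if "x \<in> Q" for x
    using automorphismD(2)[OF gi] f[OF that] unfolding f'_def by simp
  have gf': "g (f' x) = f x" if "x \<in> Q" for x
    using bij_betw_inv_into_right[OF bijg f(1)[OF that]] unfolding f'_def .
  have injf': "inj_on f' Q"
    using injf gf' unfolding inj_on_def by metis
  have f'P: "f' x = x" if "x \<in> P" for x
    using bij_betw_inv_into_left[OF bijg] that g(2) sub unfolding f'_def by (metis subsetD)
  have pow: "f' ((\<theta> ^^ i) b) = (\<theta> ^^ i) (f' b)" for i
    using funpow_commute[of Q \<theta> f' b i] QC f'hom b(3) by blast
  have powQ: "(\<theta> ^^ i) b \<in> Q" for i using funpow_closed[of Q \<theta> b i] QC b(3) by blast
  have n_gen: "n_generated_subalgebra 1 (generated \<theta> {y}) A \<theta>" if "y \<in> A" for y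
    unfolding n_generated_subalgebra_def subalgebra_def
    using that generated_superset[of "{y}" \<theta>] generated_subset[of A \<theta> "{y}"] closed generated_closed
    by (auto intro!: exI[of _ "{y}"])
  have "f' ` generated \<theta> {b} = generated \<theta> {f' b}"
  proof -
    have orbit: "generated \<theta> {y} = range (\<lambda>i. (\<theta> ^^ i) y)" for y
      unfolding generated_def by auto
    show ?thesis unfolding orbit image_image pow ..
  qed
  \<comment> \<open>Restricted to the orbit of \<open>b\<close>, \<open>f'\<close> relates two
    1-generated subalgebras, so 1-ultrahomogeneity supplies \<open>h\<close>.\<close>
  then have "isomorphism \<theta> f' (generated \<theta> {b}) (generated \<theta> {f' b})"
    unfolding isomorphism_def bij_betw_def
    using injf' f'hom Q by (auto intro: inj_on_subset)
  with n_gen[OF b(1)] n_gen[OF f'A[OF b(3)]]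
  obtain h where h: "automorphism \<theta> h A" "\<forall>x\<in>generated \<theta> {b}. h x = f' x"
    using uh unfolding n_ultrahomogeneous_def by blast
  have "b \<in> generated \<theta> {b}" using generated_superset[of "{b}" \<theta>] by blast
  with h(2) have hb: "h b = f' b" by blast
  have "(\<theta> ^^ i) (h b) \<in> P \<longleftrightarrow> (\<theta> ^^ i) b \<in> P" for i
  proof
    \<comment> \<open>A point of \<open>P\<close> is its own image under \<open>f'\<close>, so
      injectivity on \<open>Q\<close> identifies it with the point of the orbit of \<open>b\<close>
      mapped to it.\<close>
    assume *: "(\<theta> ^^ i) (h b) \<in> P"
    then have "f' ((\<theta> ^^ i) b) = f' ((\<theta> ^^ i) (h b))" using f'P pow hb by metis
    then have "(\<theta> ^^ i) b = (\<theta> ^^ i) (h b)"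
      using inj_onD[OF injf'] * powQ Q by blast
    then show "(\<theta> ^^ i) b \<in> P" using * by simp
  qed (use f'P pow hb in metis)
  moreover have "(\<theta> ^^ i) (h b) = (\<theta> ^^ i) b" if "(\<theta> ^^ i) b \<in> P" for i
    using that f'P pow hb by metis
  ultimately obtain k where k: "automorphism \<theta> k A" "\<forall>x\<in>P. k x = x" "k b = h b"
    using extend_identity[of A \<theta> P b h] closed PC b(1) h(1) sub by blast
  \<comment> \<open>On \<open>P\<close>, \<open>k\<close> is the identity and \<open>g\<close>
    agrees with \<open>f\<close>; on the orbit of \<open>b\<close>, \<open>k\<close> agrees with
    \<open>f'\<close>, and \<open>g\<close> turns \<open>f'\<close> back into
    \<open>f\<close>.\<close>
  have "(g \<circ> k) x = f x" if xQ: "x \<in> Q" for x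
  proof (cases "x \<in> P")
    case True then show ?thesis using k(2) g(2) by simp
  next
    case False
    then obtain i where x: "x = (\<theta> ^^ i) b" using xQ Q unfolding generated_def by auto
    have "k x = (\<theta> ^^ i) (k b)"
      unfolding x using funpow_commute[of A \<theta> k b i] closed automorphismD(2)[OF k(1)] b(1) by blast
    also have "\<dots> = f' x" using k(3) hb pow x by simp
    finally show ?thesis using gf'[OF xQ] by simp
  qed
  then show ?case using automorphism_comp[OF g(1) k(1)] unfolding Q_def by blast
qed

theorem proposition4p1:
  fixes A :: "'a set" and \<theta> :: "'a \<Rightarrow> 'a"
  assumes "monounary_algebra A \<theta>"
  shows "ultrahomogeneous A \<theta> \<longleftrightarrow> n_ultrahomogeneous 1 A \<theta>"
proof
  assume "ultrahomogeneous A \<theta>"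
  then show "n_ultrahomogeneous 1 A \<theta>" unfolding ultrahomogeneous_def by simp
next
  assume uh: "n_ultrahomogeneous 1 A \<theta>"
  have closed: "\<And>x. x \<in> A \<Longrightarrow> \<theta> x \<in> A" using assms unfolding monounary_algebra_def by auto
  have "\<exists>g. automorphism \<theta> g A \<and> (\<forall>x\<in>B. g x = f x)"
    if B: "n_generated_subalgebra n B A \<theta>" and C: "n_generated_subalgebra n C A \<theta>"
      and f: "isomorphism \<theta> f B C" for n B C f
  proof -
    obtain X where X: "finite X" "X \<subseteq> A" "B = generated \<theta> X"
      using B unfolding n_generated_subalgebra_def by auto
    have "C \<subseteq> A" using C unfolding n_generated_subalgebra_def subalgebra_def by auto
    then have "f ` B \<subseteq> A" "inj_on f B" "\<And>x. x \<in> B \<Longrightarrow> f (\<theta> x) = \<theta> (f x)"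
      using f unfolding isomorphism_def bij_betw_def by auto
    then show ?thesis using one_ultrahomogeneous_extend[OF closed uh X(1,2)] X(3) by auto
  qed
  then show "ultrahomogeneous A \<theta>"
    unfolding ultrahomogeneous_def n_ultrahomogeneous_def by blast
qed

end
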